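(* Let $r$ be an odd positive integer and let $\alpha,b,c\in\mathbb C$. Then $$\sum_{k=0}^r(2b)^{r-k}\binom{(r-1-\alpha)/2}{r-k}\binom{\alpha}{k}T_k(b,c)=0.$$ In particular, for all integers $m,n\ge0$, $$\sum_{k=[n-m]_+}^{2n+1}(-1)^k(2b)^{2n+1-k}\binom{m+n+1}{m-n+k}\binom{2m+k+1}{k}T_k(b,c)=0.$$
   Context: $\binom{\beta}{k}=\beta(\beta-1)\cdots(\beta-k+1)/k!$ for $\beta\in\mathbb C$, and $[x]_+:=\max(x,0)$. For $b,c\in\mathbb C$, the generalized central trinomial coefficient is $$T_n(b,c):=[x^0]\,(b+x+cx^{-1})^n=\sum_{j=0}^{\lfloor n/2\rfloor}\binom{n}{2j}\binom{2j}{j}b^{n-2j}c^j,$$ where $[x^0]$ denotes the constant term of a Laurent polynomial in $x$; the convention $0^0=1$ is used. *)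

theory Defs
  imports Complex_Main "HOL-Computational_Algebra.Formal_Laurent_Series"
begin

text \<open>
  The Laurent polynomial \<open>b + x + c x\<^sup>-\<^sup>1\<close> is read as a formal Laurent series with \<open>x\<close> being
  \<^const>\<open>fls_X\<close>, so that \<open>[x\<^sup>0]\<close> is the coefficient at index 0.
\<close>

definition gen_central_trinomial :: "complex \<Rightarrow> complex \<Rightarrow> nat \<Rightarrow> complex" where
  "gen_central_trinomial b c n =
     fls_nth ((fls_const b + fls_X + fls_const c * fls_X_inv) ^ n) 0"

lemma fls_nth_sum_distrib: "fls_nth (\<Sum>i\<in>A. f i) n = (\<Sum>i\<in>A. fls_nth (f i) n)"
  by (induction A rule: infinite_finite_induct) auto

lemma const_term_X_plus_c_X_inv_power:
  fixes c :: complex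
  shows "fls_nth ((fls_const c * fls_X_inv + fls_X) ^ i) 0 =
         (if even i then of_nat (i choose (i div 2)) * c ^ (i div 2) else 0)"
proof -
  have "(fls_const c * fls_X_inv + fls_X) ^ i =
        (\<Sum>k\<le>i. fls_const (of_nat (i choose k) * c ^ k) * (fls_X_inv ^ k * fls_X ^ (i - k)))"
    unfolding binomial_ring
    by (intro sum.cong refl)
      (simp add: power_mult_distrib fls_const_power fls_of_nat flip: fls_const_mult_const)
  also have "fls_nth \<dots> 0 = (\<Sum>k\<le>i. if 2 * k = i then of_nat (i choose k) * c ^ k else 0)"
    unfolding fls_nth_sum_distrib
  proof (intro sum.cong refl)
    fix k assume "k \<in> {..i}"
    then have k: "k \<le> i" by simp
    have eq: "fls_X_inv ^ k * fls_X ^ (i - k) = (fls_X_intpow (int i - 2 * int k) :: complex fls)"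
      using k by (simp add: fls_X_inv_power_conv_shift_1 fls_X_power_conv_shift_1
          fls_shifted_times_simps of_nat_diff algebra_simps)
    show "fls_nth (fls_const (of_nat (i choose k) * c ^ k) * (fls_X_inv ^ k * fls_X ^ (i - k))) 0 =
          (if 2 * k = i then of_nat (i choose k) * c ^ k else 0)"
      unfolding eq by auto
  qed
  also have "\<dots> = (if even i then of_nat (i choose (i div 2)) * c ^ (i div 2) else 0)"
  proof (cases "even i")
    case True
    then have "\<And>k. 2 * k = i \<longleftrightarrow> k = i div 2" by auto
    then show ?thesis using True by simp
  next
    case False
    then have "\<And>k. 2 * k \<noteq> i" by auto
    then show ?thesis using False by simp
  qed
  finally show ?thesis .
qed

lemma gen_central_trinomial_explicit:
  "gen_central_trinomial b c n =
     (\<Sum>j\<le>n div 2. of_nat (n choose (2 * j)) * of_nat ((2 * j) choose j) * b ^ (n - 2 * j) * c ^ j)"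
proof -
  have eq: "(fls_const b + fls_X + fls_const c * fls_X_inv) ^ n =
        (\<Sum>i\<le>n. fls_const (of_nat (n choose i) * b ^ (n - i)) * (fls_const c * fls_X_inv + fls_X) ^ i)"
    (is "?l = _")
  proof -
    have "?l = ((fls_const c * fls_X_inv + fls_X) + fls_const b) ^ n"
      by (simp add: add_ac)
    then show ?thesis
      unfolding binomial_ring
      by (simp add: fls_const_power fls_of_nat mult_ac flip: fls_const_mult_const)
  qed
  have "gen_central_trinomial b c n = (\<Sum>i\<le>n. of_nat (n choose i) * b ^ (n - i) *
          (if even i then of_nat (i choose (i div 2)) * c ^ (i div 2) else 0))"
    unfolding gen_central_trinomial_def eq fls_nth_sum_distrib
    by (simp add: const_term_X_plus_c_X_inv_power)
  also have "\<dots> = (\<Sum>i\<in>(\<lambda>j. 2 * j) ` {..n div 2}. of_nat (n choose i) * b ^ (n - i) *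
          (if even i then of_nat (i choose (i div 2)) * c ^ (i div 2) else 0))"
    by (rule sum.mono_neutral_right) (auto elim!: evenE)
  also have "\<dots> = (\<Sum>j\<le>n div 2. of_nat (n choose (2 * j)) * of_nat ((2 * j) choose j) *
          b ^ (n - 2 * j) * c ^ j)"
    by (subst sum.reindex) (auto simp: inj_on_def mult_ac)
  finally show ?thesis .
qed

end

theory Submission
  imports Defs
begin

text \<open>
  Comparing coefficients of \<open>c\<^sup>j\<close> and absorbing \<open>\<alpha> gchoose (2 * j)\<close> reduces the first identity to
  \<open>[x\<^sup>s] (1 + 2x)\<^sup>\<beta> (1 + x)\<^sup>\<gamma> = 0\<close> for odd \<open>s\<close> and \<open>2\<beta> + \<gamma> = s - 1\<close>. Since
  \<open>1 + 2x = (1 + x)\<^sup>2 - x\<^sup>2\<close>, the product expands into multiples of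
  \<open>x\<^bsup>2i\<^esup> (1 + x)\<^bsup>s-1-2i\<^esup>\<close>, and for \<open>2i < s\<close> these are polynomials of degree \<open>s - 1\<close>.
  The coefficient is polynomial in \<open>\<beta>\<close>, so it suffices to expand for natural \<open>\<beta>\<close>.
  The second identity is the case \<open>\<alpha> = -2m - 2\<close>, \<open>r = 2n + 1\<close>.
\<close>

text \<open>\<open>fps_binomial \<gamma>\<close> is the formal power of 1 + X with exponent
  \<open>\<gamma>\<close>. The even powers of 1 + X from the binomial expansion of (1 + X)^2 - X^2
  therefore merge into it by adding exponents.\<close>

lemma one_plus_2X_power_mult_fps_binomial:
  "(1 + 2 * fps_X) ^ N * fps_binomial \<gamma> =
     (\<Sum>i\<le>N. of_nat (N choose i) * (- 1) ^ i *
        (fps_X ^ (2 * i) * fps_binomial (\<gamma> + 2 * of_nat (N - i) :: 'a :: field_char_0)))"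
proof -
  have "(1 + 2 * fps_X :: 'a fps) = - (fps_X\<^sup>2) + (1 + fps_X)\<^sup>2"
    by (simp add: power2_eq_square algebra_simps)
  then have "(1 + 2 * fps_X) ^ N * fps_binomial \<gamma> =
      (\<Sum>i\<le>N. of_nat (N choose i) * (- (fps_X\<^sup>2)) ^ i * ((1 + fps_X)\<^sup>2) ^ (N - i) * fps_binomial \<gamma>)"
    by (simp only: binomial_ring sum_distrib_right)
  also have "\<dots> = (\<Sum>i\<le>N. of_nat (N choose i) * (- 1) ^ i *
        (fps_X ^ (2 * i) * fps_binomial (\<gamma> + 2 * of_nat (N - i))))"
  proof (intro sum.cong refl)
    fix i
    have "((1 + fps_X)\<^sup>2) ^ (N - i) * fps_binomial \<gamma> = fps_binomial (\<gamma> + 2 * of_nat (N - i))"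
    proof -
      have "2 * of_nat (N - i) = (of_nat (2 * (N - i)) :: 'a)" by simp
      then show ?thesis
        by (simp only: fps_binomial_add_mult fps_binomial_of_nat power_mult[symmetric] mult.commute)
    qed
    moreover have "(- (fps_X\<^sup>2 :: 'a fps)) ^ i = (- 1) ^ i * fps_X ^ (2 * i)"
      by (simp add: power_mult power_minus[of "fps_X\<^sup>2"])
    ultimately show "of_nat (N choose i) * (- (fps_X\<^sup>2)) ^ i * ((1 + fps_X)\<^sup>2) ^ (N - i) * fps_binomial \<gamma>
       = of_nat (N choose i) * (- 1) ^ i * (fps_X ^ (2 * i) * fps_binomial (\<gamma> + 2 * of_nat (N - i)))"
      by (simp add: mult.assoc)
  qed
  finally show ?thesis .
qed

text \<open>Substituting 2X for X in the binomial series scales the i-th coefficient by 2^i. The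
  form with \<open>gchoose\<close> is the one that later extends from \<open>N\<close> to arbitrary
  \<open>\<beta>\<close>.\<close>

lemma fps_nth_one_plus_2X_power:
  "fps_nth ((1 + 2 * fps_X) ^ N) i = 2 ^ i * (of_nat N gchoose i :: 'a :: field_char_0)"
proof -
  have "(1 + 2 * fps_X :: 'a fps) = (1 + fps_X) oo (fps_const 2 * fps_X)"
    by (simp add: fps_compose_add_distrib numeral_fps_const)
  then have "(1 + 2 * fps_X :: 'a fps) ^ N = fps_binomial (of_nat N) oo (fps_const 2 * fps_X)"
    by (simp add: fps_binomial_of_nat fps_compose_power)
  then show ?thesis by simp
qed

text \<open>The sum is a Cauchy product, and expanding that product leaves at index i the
  coefficient of X^(s-2i) in (1 + X)^(s-1-2i): one more than the degree whenever 2i < s.\<close>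

lemma sum_gbinomial_odd_eq_0_of_nat:
  assumes "odd s"
  shows "(\<Sum>i=0..s. 2 ^ i * (of_nat N gchoose i) *
           ((of_nat s - 1 - 2 * of_nat N) gchoose (s - i))) = (0 :: 'a :: field_char_0)"
proof -
  have "(\<Sum>i=0..s. 2 ^ i * (of_nat N gchoose i) * ((of_nat s - 1 - 2 * of_nat N) gchoose (s - i)) :: 'a)
      = fps_nth ((1 + 2 * fps_X) ^ N * fps_binomial (of_nat s - 1 - 2 * of_nat N)) s"
    by (simp add: fps_mult_nth fps_nth_one_plus_2X_power)
  also have "\<dots> = (\<Sum>i\<le>N. (of_nat (N choose i) * (- 1) ^ i) * (if s < 2 * i then 0 else
      (of_nat s - 1 - 2 * of_nat N + 2 * of_nat (N - i)) gchoose (s - 2 * i)) :: 'a)"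
    unfolding one_plus_2X_power_mult_fps_binomial fps_sum_nth
  proof (intro sum.cong refl)
    fix i
    have "of_nat (N choose i) * (- 1) ^ i = (fps_const (of_nat (N choose i) * (- 1) ^ i) :: 'a fps)"
      by (simp add: fps_of_nat fps_const_power fps_const_neg flip: fps_const_mult fps_const_1_eq_1)
    then show "fps_nth (of_nat (N choose i) * (- 1) ^ i * (fps_X ^ (2 * i) *
         fps_binomial (of_nat s - 1 - 2 * of_nat N + 2 * of_nat (N - i)))) s =
       (of_nat (N choose i) * (- 1) ^ i) * (if s < 2 * i then 0 else
      (of_nat s - 1 - 2 * of_nat N + 2 * of_nat (N - i)) gchoose (s - 2 * i) :: 'a)"
      by (simp only: fps_mult_left_const_nth fps_X_power_mult_nth fps_binomial_nth)
  qed
  also have "\<dots> = 0"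
  proof (intro sum.neutral ballI)
    fix i assume "i \<in> {..N}"
    have "(of_nat s - 1 - 2 * of_nat N + 2 * of_nat (N - i)) gchoose (s - 2 * i) = (0 :: 'a)"
      if "\<not> s < 2 * i"
    proof -
      \<comment> \<open>Oddness excludes the one bad index: for 2i = s the coefficient would be -1
        \<open>gchoose\<close> 0, which is 1.\<close>
      have "2 * i \<noteq> s" using assms by auto
      then have lt: "2 * i < s" using that by simp
      then have "of_nat s - 1 - 2 * of_nat N + 2 * of_nat (N - i) = (of_nat (s - 2 * i - 1) :: 'a)"
        using \<open>i \<in> {..N}\<close> by (simp add: of_nat_diff algebra_simps)
      then show ?thesis using lt by (simp only: flip: binomial_gbinomial) simp
    qed
    then show "(of_nat (N choose i) * (- 1) ^ i) * (if s < 2 * i then 0 else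
      (of_nat s - 1 - 2 * of_nat N + 2 * of_nat (N - i)) gchoose (s - 2 * i)) = (0 :: 'a)"
      by simp
  qed
  finally show ?thesis .
qed

lemma poly_eq_gbinomial:
  fixes p :: "'a :: field_char_0 poly"
  shows "\<exists>q. \<forall>x. poly q x = (poly p x gchoose k)"
proof (intro exI allI)
  show "poly (smult (inverse (fact k)) (\<Prod>i=0..<k. p - of_nat i)) x = (poly p x gchoose k)" for x
    by (simp add: gbinomial_prod_rev poly_prod divide_inverse mult.commute)
qed

lemma poly_eq_0_of_nat_zeros:
  fixes p :: "'a :: field_char_0 poly"
  assumes "\<And>N. poly p (of_nat N) = 0"
  shows "p = 0"
proof (rule ccontr)
  assume "p \<noteq> 0"
  then have "finite {x. poly p x = 0}" by (rule poly_roots_finite)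
  then have "finite (range (of_nat :: nat \<Rightarrow> 'a))"
    by (rule rev_finite_subset) (use assms in auto)
  then show False
    using finite_imageD[OF _ inj_of_nat] by auto
qed

text \<open>The lower indices do not involve \<open>\<beta>\<close>, so the sum is the value at
  \<open>\<beta>\<close> of one fixed polynomial, and this polynomial vanishes at every natural
  number.\<close>

lemma sum_gbinomial_odd_eq_0:
  fixes \<beta> :: "'a :: field_char_0"
  assumes "odd s"
  shows "(\<Sum>i=0..s. 2 ^ i * (\<beta> gchoose i) * ((of_nat s - 1 - 2 * \<beta>) gchoose (s - i))) = 0"
proof -
  have "\<exists>q. \<forall>x :: 'a. poly q x = (x gchoose i)" for i
    using poly_eq_gbinomial[of "[:0, 1:] :: 'a poly" i] by auto
  then obtain f :: "nat \<Rightarrow> 'a poly" where f: "poly (f i) x = (x gchoose i)" for i x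
    by metis
  have "\<exists>q. \<forall>x :: 'a. poly q x = ((of_nat s - 1 - 2 * x) gchoose i)" for i
    using poly_eq_gbinomial[of "[:of_nat s - 1, - 2:] :: 'a poly" i] by (auto simp: mult.commute)
  then obtain g :: "nat \<Rightarrow> 'a poly" where g: "poly (g i) x = ((of_nat s - 1 - 2 * x) gchoose i)" for i x
    by metis
  define p where "p = (\<Sum>i=0..s. smult (2 ^ i) (f i * g (s - i)))"
  have p: "poly p x = (\<Sum>i=0..s. 2 ^ i * (x gchoose i) * ((of_nat s - 1 - 2 * x) gchoose (s - i)))" for x
    by (simp add: p_def poly_sum f g mult.assoc)
  have "p = 0"
    using sum_gbinomial_odd_eq_0_of_nat[OF assms] by (intro poly_eq_0_of_nat_zeros) (simp add: p)
  with p[of \<beta>] show ?thesis by simp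
qed

text \<open>Up to a factor independent of \<open>k\<close>, this is the coefficient of c^j in the
  first identity. Trinomial revision trades the product of the last two binomials for
  (\<open>\<alpha> gchoose (2 * j)\<close>) times (\<open>\<alpha>\<close> - 2j)
  \<open>gchoose\<close> (k - 2j), and the shift k = i + 2j then gives the previous lemma with s = r
  - 2j.\<close>

lemma sum_gbinomial_binomial_eq_0:
  fixes \<alpha> :: "'a :: field_char_0"
  assumes "odd r"
  shows "(\<Sum>k=0..r. 2 ^ (r - k) * (((of_nat r - 1 - \<alpha>) / 2) gchoose (r - k)) * (\<alpha> gchoose k) *
           of_nat (k choose (2 * j))) = 0"
proof (cases "2 * j \<le> r")
  case True
  define s where "s = r - 2 * j"
  have s: "odd s" "r = s + 2 * j" using True assms by (auto simp: s_def)
  define \<beta> where "\<beta> = (of_nat r - 1 - \<alpha>) / 2"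
  \<comment> \<open>Lowering \<open>r\<close> and \<open>\<alpha>\<close> both by 2j leaves
    \<open>\<beta>\<close> unchanged, so the upper indices keep the relation needed for
    \<open>s\<close>.\<close>
  have \<gamma>: "\<alpha> - of_nat (2 * j) = of_nat s - 1 - 2 * \<beta>" 
  proof -
    have "2 * \<beta> = of_nat r - 1 - \<alpha>" by (simp add: \<beta>_def)
    then show ?thesis by (simp add: s(2))
  qed
  have "(\<Sum>k=0..r. 2 ^ (r - k) * (\<beta> gchoose (r - k)) * (\<alpha> gchoose k) * of_nat (k choose (2 * j)))
     = (\<Sum>k=2*j..s+2*j. 2 ^ (r - k) * (\<beta> gchoose (r - k)) * (\<alpha> gchoose k) * of_nat (k choose (2 * j)))"
    by (rule sum.mono_neutral_right) (auto simp: s(2))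
  also have "\<dots> = (\<Sum>i=0..s. 2 ^ (s - i) * (\<beta> gchoose (s - i)) *
       ((\<alpha> gchoose (i + 2 * j)) * of_nat ((i + 2 * j) choose (2 * j))))"
    by (simp add: s(2) mult.assoc sum.shift_bounds_cl_nat_ivl[of _ 0 "2 * j" s, simplified])
  also have "\<dots> = (\<Sum>i=0..s. (\<alpha> gchoose (2 * j)) * (2 ^ (s - i) * (\<beta> gchoose (s - i)) *
       ((of_nat s - 1 - 2 * \<beta>) gchoose i)))"
  proof (intro sum.cong refl)
    fix i
    have "(\<alpha> gchoose (i + 2 * j)) * of_nat ((i + 2 * j) choose (2 * j)) =
        (\<alpha> gchoose (2 * j)) * ((of_nat s - 1 - 2 * \<beta>) gchoose i)"
      using gbinomial_trinomial_revision[of "2 * j" "i + 2 * j" \<alpha>]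
      by (simp only: binomial_gbinomial \<gamma> le_add2 add_diff_cancel_right')
    then show "2 ^ (s - i) * (\<beta> gchoose (s - i)) *
        ((\<alpha> gchoose (i + 2 * j)) * of_nat ((i + 2 * j) choose (2 * j))) =
        (\<alpha> gchoose (2 * j)) * (2 ^ (s - i) * (\<beta> gchoose (s - i)) *
        ((of_nat s - 1 - 2 * \<beta>) gchoose i))"
      by (simp only: mult_ac)
  qed
  also have "\<dots> = (\<alpha> gchoose (2 * j)) * (\<Sum>i=0..s. 2 ^ i * (\<beta> gchoose i) *
       ((of_nat s - 1 - 2 * \<beta>) gchoose (s - i)))"
    unfolding sum_distrib_left[symmetric] by (subst sum.atLeastAtMost_rev) simp
  finally show ?thesis
    using sum_gbinomial_odd_eq_0[OF s(1), of \<beta>] by (simp add: \<beta>_def)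
qed (auto intro!: sum.neutral)

lemma sum_gbinomial_gen_central_trinomial_eq_0:
  assumes "odd r"
  shows "(\<Sum>k=0..r. (2 * b) ^ (r - k) * (((of_nat r - 1 - \<alpha>) / 2) gchoose (r - k)) * (\<alpha> gchoose k) *
           gen_central_trinomial b c k) = 0"
proof -
  define \<beta> where "\<beta> = (of_nat r - 1 - \<alpha>) / 2"
  \<comment> \<open>The range of j is made the same for all k, so that the two sums can be swapped;
    the added terms have 2j > k and vanish.\<close>
  have T: "gen_central_trinomial b c k = (\<Sum>j\<le>r div 2. of_nat (k choose (2 * j)) *
      of_nat ((2 * j) choose j) * b ^ (k - 2 * j) * c ^ j)" if "k \<le> r" for k
    unfolding gen_central_trinomial_explicit
    by (rule sum.mono_neutral_left) (use that in \<open>auto simp: div_le_mono\<close>)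
  have "(\<Sum>k=0..r. (2 * b) ^ (r - k) * (\<beta> gchoose (r - k)) * (\<alpha> gchoose k) * gen_central_trinomial b c k)
     = (\<Sum>k=0..r. \<Sum>j\<le>r div 2. (of_nat ((2 * j) choose j) * b ^ (r - 2 * j) * c ^ j) *
          (2 ^ (r - k) * (\<beta> gchoose (r - k)) * (\<alpha> gchoose k) * of_nat (k choose (2 * j))))"
  proof (intro sum.cong refl)
    fix k assume k: "k \<in> {0..r}"
    have "(2 * b) ^ (r - k) * (\<beta> gchoose (r - k)) * (\<alpha> gchoose k) *
        (of_nat (k choose (2 * j)) * of_nat ((2 * j) choose j) * b ^ (k - 2 * j) * c ^ j) =
        (of_nat ((2 * j) choose j) * b ^ (r - 2 * j) * c ^ j) *
          (2 ^ (r - k) * (\<beta> gchoose (r - k)) * (\<alpha> gchoose k) * of_nat (k choose (2 * j)))" for j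
    \<comment> \<open>For 2j <= k the powers of \<open>b\<close> combine to an exponent free of k.
      Otherwise k - 2j is truncated to 0, but both sides contain a zero binomial.\<close>
    proof (cases "2 * j \<le> k")
      case True
      then have "b ^ (r - 2 * j) = b ^ (r - k) * b ^ (k - 2 * j)"
        using k by (simp flip: power_add)
      then show ?thesis by (simp add: power_mult_distrib)
    qed simp
    then show "(2 * b) ^ (r - k) * (\<beta> gchoose (r - k)) * (\<alpha> gchoose k) * gen_central_trinomial b c k =
       (\<Sum>j\<le>r div 2. (of_nat ((2 * j) choose j) * b ^ (r - 2 * j) * c ^ j) *
          (2 ^ (r - k) * (\<beta> gchoose (r - k)) * (\<alpha> gchoose k) * of_nat (k choose (2 * j))))"
      using k by (simp only: T sum_distrib_left atLeastAtMost_iff)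
  qed
  also have "\<dots> = (\<Sum>j\<le>r div 2. (of_nat ((2 * j) choose j) * b ^ (r - 2 * j) * c ^ j) *
      (\<Sum>k=0..r. 2 ^ (r - k) * (\<beta> gchoose (r - k)) * (\<alpha> gchoose k) * of_nat (k choose (2 * j))))"
    by (subst sum.swap) (simp add: sum_distrib_left)
  also have "\<dots> = 0"
    unfolding \<beta>_def sum_gbinomial_binomial_eq_0[OF assms] by simp
  finally show ?thesis by (simp add: \<beta>_def)
qed

lemma sum_binomial_gen_central_trinomial_eq_0:
  "(\<Sum>k = nat (max (int n - int m) 0)..2 * n + 1. (-1) ^ k * (2 * b) ^ (2 * n + 1 - k) *
      of_nat ((m + n + 1) choose nat (int m - int n + int k)) *
      of_nat ((2 * m + k + 1) choose k) * gen_central_trinomial b c k) = 0"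
proof -
  \<comment> \<open>This value solves (r - 1 - \<open>\<alpha>\<close>)/2 = m + n + 1 for r = 2n +
    1. Negating the upper index of \<open>\<alpha> gchoose k\<close> then produces the sign and the
    binomial with upper index 2m + k + 1.\<close>
  define \<alpha> :: complex where "\<alpha> = - of_nat (2 * m + 2)"
  have \<beta>: "(of_nat (2 * n + 1) - 1 - \<alpha>) / 2 = of_nat (m + n + 1)"
    by (simp add: \<alpha>_def field_simps)
  have A: "(\<alpha> gchoose k) = (-1) ^ k * of_nat ((2 * m + k + 1) choose k)" for k
  proof -
    have "of_nat k - \<alpha> - 1 = (of_nat (2 * m + k + 1) :: complex)" by (simp add: \<alpha>_def)
    then show ?thesis
      by (simp only: gbinomial_negated_upper[of \<alpha>] binomial_gbinomial)
  qed
  have "(\<Sum>k = nat (max (int n - int m) 0)..2 * n + 1. (-1) ^ k * (2 * b) ^ (2 * n + 1 - k) *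
      of_nat ((m + n + 1) choose nat (int m - int n + int k)) *
      of_nat ((2 * m + k + 1) choose k) * gen_central_trinomial b c k) =
    (\<Sum>k = nat (max (int n - int m) 0)..2 * n + 1. (2 * b) ^ (2 * n + 1 - k) *
      of_nat ((m + n + 1) choose (2 * n + 1 - k)) * (\<alpha> gchoose k) * gen_central_trinomial b c k)"
  proof (intro sum.cong refl)
    fix k assume k: "k \<in> {nat (max (int n - int m) 0)..2 * n + 1}"
    \<comment> \<open>The two lower indices are complementary in m + n + 1. The bound k >= n - m
      keeps the argument of \<open>nat\<close> nonnegative.\<close>
    then have "nat (int m - int n + int k) = m + n + 1 - (2 * n + 1 - k)" "2 * n + 1 - k \<le> m + n + 1"
      by auto
    then have "(m + n + 1) choose nat (int m - int n + int k) = (m + n + 1) choose (2 * n + 1 - k)"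
      by (simp only: binomial_symmetric[symmetric])
    then show "(-1) ^ k * (2 * b) ^ (2 * n + 1 - k) *
      of_nat ((m + n + 1) choose nat (int m - int n + int k)) *
      of_nat ((2 * m + k + 1) choose k) * gen_central_trinomial b c k =
      (2 * b) ^ (2 * n + 1 - k) *
      of_nat ((m + n + 1) choose (2 * n + 1 - k)) * (\<alpha> gchoose k) * gen_central_trinomial b c k"
      by (simp only: A mult_ac)
  qed
  also have "\<dots> = (\<Sum>k = 0..2 * n + 1. (2 * b) ^ (2 * n + 1 - k) *
      of_nat ((m + n + 1) choose (2 * n + 1 - k)) * (\<alpha> gchoose k) * gen_central_trinomial b c k)"
  proof (rule sum.mono_neutral_left)
    show "\<forall>k \<in> {0..2 * n + 1} - {nat (max (int n - int m) 0)..2 * n + 1}. (2 * b) ^ (2 * n + 1 - k) *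
      of_nat ((m + n + 1) choose (2 * n + 1 - k)) * (\<alpha> gchoose k) * gen_central_trinomial b c k = 0"
    proof
      fix k assume "k \<in> {0..2 * n + 1} - {nat (max (int n - int m) 0)..2 * n + 1}"
      \<comment> \<open>Here k < n - m, so the lower index exceeds the upper one; this explains the
        starting point of the sum.\<close>
      then have "m + n + 1 < 2 * n + 1 - k" by auto
      then show "(2 * b) ^ (2 * n + 1 - k) * of_nat ((m + n + 1) choose (2 * n + 1 - k)) *
        (\<alpha> gchoose k) * gen_central_trinomial b c k = 0"
        by (simp only: binomial_eq_0 of_nat_0 mult_zero_left mult_zero_right)
    qed
  qed auto
  also have "\<dots> = 0"
    using sum_gbinomial_gen_central_trinomial_eq_0[of "2 * n + 1" b \<alpha> c]
    by (simp only: \<beta> binomial_gbinomial) simp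
  finally show ?thesis .
qed

theorem corollary6p6:
  fixes b c :: complex
  shows "(\<forall>(r::nat) (\<alpha>::complex). odd r \<longrightarrow>
            (\<Sum>k=0..r. (2 * b) ^ (r - k) *
               (((of_nat r - 1 - \<alpha>) / 2) gchoose (r - k)) * (\<alpha> gchoose k) *
               gen_central_trinomial b c k) = 0) \<and>
         (\<forall>(m::nat) (n::nat).
            (\<Sum>k = nat (max (int n - int m) 0)..2 * n + 1. (-1) ^ k * (2 * b) ^ (2 * n + 1 - k) *
               of_nat ((m + n + 1) choose nat (int m - int n + int k)) *
               of_nat ((2 * m + k + 1) choose k) *
               gen_central_trinomial b c k) = 0)"
  using sum_gbinomial_gen_central_trinomial_eq_0 sum_binomial_gen_central_trinomial_eq_0 by blast

end
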